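(* Let $n\le 4$ be a positive integer. No parallel chip-firing game on any orientation of the complete graph $K_n$ has period $T=2$.
   Context: A directed graph $D=(V,E)$ is a finite set of vertices $V$ with a set $E$ of ordered pairs of vertices; $(u,v)\in E$ is an edge directed from $u$ to $v$, and the out-degree $\deg^+ v$ is the number of edges directed from $v$. An orientation of an undirected graph $G$ is a directed graph on the same vertex set obtained by replacing each edge $\{u,v\}$ of $G$ by exactly one of $(u,v)$, $(v,u)$. A parallel chip-firing game on $D$ starts with a finite nonnegative integer number of chips on each vertex. In each round, simultaneously, every vertex $v$ having at least $\deg^+ v$ chips fires, sending one chip along each of its outgoing edges; all other vertices wait. The game has period $T$ if $T$ is the smallest positive integer for which there is a round $t_0$ such that every vertex has the same number of chips in round $t$ as in round $t+T$ for all $t\ge t_0$. *)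

theory Defs
  imports "Graph_Theory.Kuratowski"
begin

text \<open>
  As everywhere in \<open>Graph_Theory\<close>, an undirected graph \<open>G\<close> is a symmetric loop-free digraph: the
  edge \<open>{u, v}\<close> is the pair of arcs \<open>(u, v)\<close>, \<open>(v, u)\<close>. An orientation keeps exactly one of the two.
\<close>

definition orientation_of :: "'a pair_pre_digraph \<Rightarrow> 'a pair_pre_digraph \<Rightarrow> bool" where
  "orientation_of D G \<longleftrightarrow>
     pverts D = pverts G \<and> parcs D \<subseteq> parcs G \<and>
     (\<forall>u v. (u, v) \<in> parcs G \<longrightarrow> ((u, v) \<in> parcs D \<longleftrightarrow> (v, u) \<notin> parcs D))"

type_synonym 'a chips = "'a \<Rightarrow> nat"

text \<open>A vertex of out-degree 0 fires in every round, sending no chips.\<close>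

definition fires :: "'a pair_pre_digraph \<Rightarrow> 'a chips \<Rightarrow> 'a \<Rightarrow> bool" where
  "fires D c v \<longleftrightarrow> out_degree (with_proj D) v \<le> c v"

text \<open>The subtraction does not truncate, by the definition of \<open>fires\<close>.\<close>

definition fire_step :: "'a pair_pre_digraph \<Rightarrow> 'a chips \<Rightarrow> 'a chips" where
  "fire_step D c v =
     (if fires D c v then c v - out_degree (with_proj D) v else c v) +
     card {e \<in> in_arcs (with_proj D) v. fires D c (fst e)}"

definition chips_at :: "'a pair_pre_digraph \<Rightarrow> 'a chips \<Rightarrow> nat \<Rightarrow> 'a chips" where
  "chips_at D c t = (fire_step D ^^ t) c"

definition eventually_repeats :: "'a pair_pre_digraph \<Rightarrow> 'a chips \<Rightarrow> nat \<Rightarrow> bool" where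
  "eventually_repeats D c T \<longleftrightarrow>
     (\<exists>t0. \<forall>t\<ge>t0. \<forall>v\<in>pverts D. chips_at D c t v = chips_at D c (t + T) v)"

definition has_period :: "'a pair_pre_digraph \<Rightarrow> 'a chips \<Rightarrow> nat \<Rightarrow> bool" where
  "has_period D c T \<longleftrightarrow>
     T > 0 \<and> eventually_repeats D c T \<and>
     (\<forall>T'. 0 < T' \<and> T' < T \<longrightarrow> \<not> eventually_repeats D c T')"

end

theory Submission
  imports Defs
begin

text \<open>
  On the attractor of a game of period 2, let \<open>f v\<close> be the number of times \<open>v\<close> fires during two
  consecutive rounds. As the chips return, \<open>f v \<le> 2\<close> and \<open>deg\<^sup>+ v * f v\<close> is the sum of \<open>f u\<close> over
  the in-neighbours \<open>u\<close> of \<open>v\<close>. On a tournament with at most four vertices, this forces any \<open>x\<close> of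
  positive out-degree with \<open>f x = 1\<close> to lie on a directed triangle on which \<open>f\<close> is 1 and outside of
  which \<open>f\<close> is 0. (The strong tournament on four vertices would need \<open>f\<close> proportional to 1, 2, 3, 4.)
  On the triangle a vertex waits right after firing only if its predecessor did not fire together
  with it, so consecutive vertices fire in alternate rounds, which is impossible on an odd cycle.
  Hence every vertex fires in both rounds or in neither, and the position does not change at all.
\<close>

text \<open>Let every arc leaving \<open>v\<close> carry \<open>f v\<close>; then
  \<open>balance\<close> says that this is a circulation. A circulation vanishes on arcs between
  strong components, and being positive propagates along arcs, so \<open>x\<close> lies in a strong
  component with at least three vertices that no arc leaves. If it has three, it is a triangle with
  constant \<open>f\<close>, and a fourth vertex is a source, hence has \<open>f\<close> equal to 0.
  It cannot have four, by \<open>le_2\<close>.\<close>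

lemma tournament_card_le_4_unit_flow:
  fixes E :: "'a \<Rightarrow> 'a \<Rightarrow> bool" and f :: "'a \<Rightarrow> nat"
  assumes "finite V" "card V \<le> 4" "x \<in> V"
    and tournament: "\<And>u v. u \<in> V \<Longrightarrow> v \<in> V \<Longrightarrow> u \<noteq> v \<Longrightarrow> E u v \<longleftrightarrow> \<not> E v u"
    and irrefl: "\<And>v. v \<in> V \<Longrightarrow> \<not> E v v"
    and balance: "\<And>v. v \<in> V \<Longrightarrow>
      f v * (\<Sum>w\<in>V. of_bool (E v w)) = (\<Sum>u\<in>V. of_bool (E u v) * f u)"
    and le_2: "\<And>v. v \<in> V \<Longrightarrow> f v \<le> 2"
    and fx: "f x = 1" and "E x s" "s \<in> V"
  shows "\<exists>y z. y \<in> V \<and> z \<in> V \<and> E x y \<and> E y z \<and> E z x \<and> f y = 1 \<and> f z = 1 \<and>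
    (\<forall>u \<in> V - {x, y, z}. f u = 0)"
proof -
  have flow: "(\<Sum>w\<in>V. if E v w then f v else 0) = (\<Sum>u\<in>V. if E u v then f u else 0)"
    if "v \<in> V" for v
  proof -
    have "f v * (\<Sum>w\<in>V. of_bool (E v w)) = (\<Sum>w\<in>V. if E v w then f v else 0)"
      unfolding sum_distrib_left by (intro sum.cong) auto
    moreover have "(\<Sum>u\<in>V. of_bool (E u v) * f u) = (\<Sum>u\<in>V. if E u v then f u else 0)"
      by (intro sum.cong) auto
    ultimately show ?thesis
      using balance[OF that] by simp
  qed
  have "card (V - {x}) \<le> 3"
    using assms(1-3) by simp
  moreover have "s \<in> V - {x}"
    using \<open>E x s\<close> \<open>s \<in> V\<close> irrefl by auto
  then have "card (V - {x}) \<noteq> 0"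
    using \<open>finite V\<close> by auto
  ultimately consider "card (V - {x}) = 1" | "card (V - {x}) = 2" | "card (V - {x}) = 3"
    by linarith
  then show ?thesis
  proof cases
    case 1
    then have "V - {x} = {s}"
      using \<open>s \<in> V - {x}\<close> by (metis card_1_singletonE singletonD)
    then have V: "V = {x, s}" and "x \<noteq> s"
      using \<open>x \<in> V\<close> by auto
    then have "\<not> E s x" "\<not> E x x"
      using \<open>E x s\<close> tournament[of x s] irrefl[of x] by auto
    \<comment> \<open>Here \<open>x\<close> is a source, so conservation at \<open>x\<close> reads 1
      = 0.\<close>
    then show ?thesis
      using flow[of x] \<open>E x s\<close> \<open>x \<noteq> s\<close> fx by (simp add: V)
  next
    case 2
    then obtain y z where "V - {x} = {y, z}" "y \<noteq> z"
      by (auto simp: card_2_iff)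
    then have V: "V = {x, y, z}" and distinct: "x \<noteq> y" "x \<noteq> z" "y \<noteq> z"
      using \<open>x \<in> V\<close> by auto
    \<comment> \<open>Rewriting reversed arcs leaves one truth value per pair of vertices, so that
      the orientations can be enumerated.\<close>
    have arcs: "\<not> E x x" "\<not> E y y" "\<not> E z z"
      "E y x \<longleftrightarrow> \<not> E x y" "E z x \<longleftrightarrow> \<not> E x z" "E z y \<longleftrightarrow> \<not> E y z"
      using irrefl tournament[of y x] tournament[of z x] tournament[of z y] distinct
      by (simp_all add: V)
    have "E x y \<or> E x z"
      using \<open>E x s\<close> \<open>s \<in> V\<close> arcs by (auto simp: V)
    moreover have
      "(if E x y then f x else 0) + (if E x z then f x else 0) =
        (if \<not> E x y then f y else 0) + (if \<not> E x z then f z else 0)"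
      "(if \<not> E x y then f y else 0) + (if E y z then f y else 0) =
        (if E x y then f x else 0) + (if \<not> E y z then f z else 0)"
      "(if \<not> E x z then f z else 0) + (if \<not> E y z then f z else 0) =
        (if E x z then f x else 0) + (if E y z then f y else 0)"
      using flow[of x] flow[of y] flow[of z] distinct
      by (simp_all add: V arcs add.assoc split del: if_split cong: if_cong)
    \<comment> \<open>A transitive orientation would have \<open>f\<close> equal to 0 first at its
      source and then at its middle vertex; only the two cyclic ones survive.\<close>
    ultimately have
      "E x y \<and> E y z \<and> \<not> E x z \<and> f y = 1 \<and> f z = 1 \<or>
       E x z \<and> \<not> E y z \<and> \<not> E x y \<and> f y = 1 \<and> f z = 1"
      using fx by (cases "E x y"; cases "E x z"; cases "E y z"; simp)
    then show ?thesis
      using distinct arcs by (elim disjE) (force simp: V)+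
  next
    case 3
    then obtain y z w where "V - {x} = {y, z, w}" "y \<noteq> z" "y \<noteq> w" "z \<noteq> w"
      by (auto simp: card_3_iff)
    then have V: "V = {x, y, z, w}"
      and distinct: "x \<noteq> y" "x \<noteq> z" "x \<noteq> w" "y \<noteq> z" "y \<noteq> w" "z \<noteq> w"
      using \<open>x \<in> V\<close> by auto
    have arcs: "\<not> E x x" "\<not> E y y" "\<not> E z z" "\<not> E w w"
      "E y x \<longleftrightarrow> \<not> E x y" "E z x \<longleftrightarrow> \<not> E x z" "E w x \<longleftrightarrow> \<not> E x w"
      "E z y \<longleftrightarrow> \<not> E y z" "E w y \<longleftrightarrow> \<not> E y w" "E w z \<longleftrightarrow> \<not> E z w"
      using irrefl tournament[of y x] tournament[of z x] tournament[of w x]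
        tournament[of z y] tournament[of w y] tournament[of w z] distinct
      by (simp_all add: V)
    \<comment> \<open>With finitely many values for \<open>f\<close>, the equations become a finite
      check over values and orientations.\<close>
    have "f v = 0 \<or> f v = 1 \<or> f v = 2" if "v \<in> V" for v
      using le_2[OF that] by linarith
    then have "f y = 0 \<or> f y = 1 \<or> f y = 2" "f z = 0 \<or> f z = 1 \<or> f z = 2"
      "f w = 0 \<or> f w = 1 \<or> f w = 2"
      by (simp_all add: V)
    moreover have "\<not> (\<not> E x y \<and> \<not> E x z \<and> \<not> E x w)"
      using \<open>E x s\<close> \<open>s \<in> V\<close> arcs by (auto simp: V)
    moreover have
      "(if E x y then f x else 0) + (if E x z then f x else 0) + (if E x w then f x else 0) =
        (if \<not> E x y then f y else 0) + (if \<not> E x z then f z else 0) + (if \<not> E x w then f w else 0)"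
      "(if \<not> E x y then f y else 0) + (if E y z then f y else 0) + (if E y w then f y else 0) =
        (if E x y then f x else 0) + (if \<not> E y z then f z else 0) + (if \<not> E y w then f w else 0)"
      "(if \<not> E x z then f z else 0) + (if \<not> E y z then f z else 0) + (if E z w then f z else 0) =
        (if E x z then f x else 0) + (if E y z then f y else 0) + (if \<not> E z w then f w else 0)"
      "(if \<not> E x w then f w else 0) + (if \<not> E y w then f w else 0) + (if \<not> E z w then f w else 0) =
        (if E x w then f x else 0) + (if E y w then f y else 0) + (if E z w then f z else 0)"
      using flow[of x] flow[of y] flow[of z] flow[of w] distinct
      by (simp_all add: V arcs add.assoc split del: if_split cong: if_cong)
    \<comment> \<open>Three choices of the vertex off the triangle, times two directions of the
      triangle.\<close>
    ultimately have
      "E x y \<and> E y z \<and> \<not> E x z \<and> f y = 1 \<and> f z = 1 \<and> f w = 0 \<or>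
       E x z \<and> \<not> E y z \<and> \<not> E x y \<and> f y = 1 \<and> f z = 1 \<and> f w = 0 \<or>
       E x y \<and> E y w \<and> \<not> E x w \<and> f y = 1 \<and> f w = 1 \<and> f z = 0 \<or>
       E x w \<and> \<not> E y w \<and> \<not> E x y \<and> f y = 1 \<and> f w = 1 \<and> f z = 0 \<or>
       E x z \<and> E z w \<and> \<not> E x w \<and> f z = 1 \<and> f w = 1 \<and> f y = 0 \<or>
       E x w \<and> \<not> E z w \<and> \<not> E x z \<and> f z = 1 \<and> f w = 1 \<and> f y = 0"
      using fx
      by (elim disjE; simp split: if_splits)
    \<comment> \<open>One statement covers all six alternatives, \<open>p\<close>, \<open>q\<close>,
      \<open>r\<close> running through the orders of \<open>y\<close>, \<open>z\<close>,
      \<open>w\<close>.\<close>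
    moreover have "\<not> (E x p \<and> E p q \<and> E q x \<and> f p = 1 \<and> f q = 1 \<and> f r = 0)"
      if "\<not> ?thesis" "V = {x, p, q, r}" for p q r
      using that by blast
    moreover have "V = {x, z, y, w}" "V = {x, y, w, z}" "V = {x, w, y, z}" "V = {x, z, w, y}"
      "V = {x, w, z, y}"
      unfolding V by blast+
    ultimately show ?thesis
      using V unfolding arcs(5-10)[symmetric] by metis
  qed
qed

text \<open>\<open>P\<close> and \<open>Q\<close> stand for firing in the first and in the second of
  two rounds after which the chips return. The hypotheses are symmetric in them, so the lemma also
  excludes firing in the second round only.\<close>

lemma tournament_card_le_4_no_single_firing:
  fixes E :: "'a \<Rightarrow> 'a \<Rightarrow> bool" and P Q :: "'a \<Rightarrow> bool"
  assumes "finite V" "card V \<le> 4" "x \<in> V"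
    and tournament: "\<And>u v. u \<in> V \<Longrightarrow> v \<in> V \<Longrightarrow> u \<noteq> v \<Longrightarrow> E u v \<longleftrightarrow> \<not> E v u"
    and irrefl: "\<And>v. v \<in> V \<Longrightarrow> \<not> E v v"
    and balance: "\<And>v. v \<in> V \<Longrightarrow>
      (of_bool (P v) + of_bool (Q v)) * (\<Sum>w\<in>V. of_bool (E v w)) =
      (\<Sum>u\<in>V. of_bool (E u v \<and> P u)) + (\<Sum>u\<in>V. of_bool (E u v \<and> Q u) :: nat)"
    and P_only: "\<And>v. v \<in> V \<Longrightarrow> P v \<Longrightarrow> \<not> Q v \<Longrightarrow>
      (\<Sum>u\<in>V. of_bool (E u v \<and> P u)) < (\<Sum>w\<in>V. of_bool (E v w) :: nat)"
    and Q_only: "\<And>v. v \<in> V \<Longrightarrow> Q v \<Longrightarrow> \<not> P v \<Longrightarrow>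
      (\<Sum>u\<in>V. of_bool (E u v \<and> Q u)) < (\<Sum>w\<in>V. of_bool (E v w) :: nat)"
    and "P x" "\<not> Q x"
  shows False
proof -
  define f :: "'a \<Rightarrow> nat" where "f v = of_bool (P v) + of_bool (Q v)" for v
  have flow: "f v * (\<Sum>w\<in>V. of_bool (E v w)) = (\<Sum>u\<in>V. of_bool (E u v) * f u)"
    if "v \<in> V" for v
  proof -
    have "(\<Sum>u\<in>V. of_bool (E u v) * f u) =
        (\<Sum>u\<in>V. of_bool (E u v \<and> P u) + of_bool (E u v \<and> Q u))"
      by (intro sum.cong) (auto simp: f_def)
    then show ?thesis
      using balance[OF that] by (simp only: f_def sum.distrib)
  qed
  \<comment> \<open>Nothing is strictly below 0, so \<open>P_only\<close> forces a positive
    out-degree.\<close>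
  have "(\<Sum>w\<in>V. of_bool (E x w)) \<noteq> (0 :: nat)"
    using P_only[of x] assms by linarith
  then obtain s where "s \<in> V" "of_bool (E x s) \<noteq> (0 :: nat)"
    by (rule sum.not_neutral_contains_not_neutral)
  then have "E x s"
    by simp
  have one: "f x = 1"
    using \<open>P x\<close> \<open>\<not> Q x\<close> by (simp add: f_def)
  have le_2: "f v \<le> 2" for v
    by (simp add: f_def)
  have "\<exists>y z. y \<in> V \<and> z \<in> V \<and> E x y \<and> E y z \<and> E z x \<and> f y = 1 \<and> f z = 1 \<and>
      (\<forall>u \<in> V - {x, y, z}. f u = 0)"
    using assms(1-5) flow le_2 one \<open>E x s\<close> \<open>s \<in> V\<close>
    by (rule tournament_card_le_4_unit_flow[where s = s])
  then obtain y z where yz: "y \<in> V" "z \<in> V" "E x y" "E y z" "E z x" "f y = 1" "f z = 1"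
    and zero: "\<forall>u \<in> V - {x, y, z}. f u = 0"
    by (elim exE conjE)
  have reverse: "\<not> E y x" "\<not> E z y" "\<not> E x z"
    using yz tournament[of x y] tournament[of y z] tournament[of z x] irrefl \<open>x \<in> V\<close> by metis+
  \<comment> \<open>If all inflow of \<open>v\<close> comes from one \<open>u\<close> with
    \<open>f u = 1\<close>, conservation makes the out-degree of \<open>v\<close> equal to
    1.\<close>
  have d: "(\<Sum>w\<in>V. of_bool (E v w)) = (1 :: nat)"
    if "v \<in> V" "f v = 1" "u \<in> V" "f u = 1"
      and in_nbr: "\<And>u'. u' \<in> V \<Longrightarrow> E u' v \<and> f u' \<noteq> 0 \<longleftrightarrow> u' = u" for u v
  proof -
    have "(\<Sum>w\<in>V. of_bool (E v w)) = (\<Sum>u'\<in>V. of_bool (E u' v) * f u')"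
      using flow[of v] that by simp
    moreover have "of_bool (E u' v) * f u' = (if u' = u then 1 else 0)" if "u' \<in> V" for u'
      using \<open>f u = 1\<close> in_nbr[OF that] by (cases "u' = u") auto
    then have "(\<Sum>u'\<in>V. of_bool (E u' v) * f u') = (\<Sum>u'\<in>V. if u' = u then 1 else 0)"
      by (intro sum.cong) auto
    ultimately show ?thesis
      using \<open>finite V\<close> \<open>u \<in> V\<close> by simp
  qed
  \<comment> \<open>Were \<open>u\<close> to fire together with \<open>v\<close>, then
    \<open>v\<close> would receive at least one chip, its whole out-degree, in the round in which it
    fires, against \<open>P_only\<close> or \<open>Q_only\<close>.\<close>
  have alternate: "P v \<longleftrightarrow> Q u"
    if that_uv: "v \<in> V" "f v = 1" "u \<in> V" "f u = 1" and "E u v"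
      and in_nbr: "\<And>u'. u' \<in> V \<Longrightarrow> E u' v \<and> f u' \<noteq> 0 \<longleftrightarrow> u' = u" for u v
  proof -
    have pos: "(\<Sum>u'\<in>V. of_bool (E u' v \<and> R u')) \<noteq> (0 :: nat)" if "R u" for R
      using that \<open>E u v\<close> \<open>u \<in> V\<close> \<open>finite V\<close> by (auto simp: sum_eq_0_iff simp del: sum_of_bool_eq)
    have unit: "P w \<longleftrightarrow> \<not> Q w" if "f w = 1" for w
      using that by (cases "P w"; cases "Q w"; simp add: f_def)
    have deg: "(\<Sum>w\<in>V. of_bool (E v w)) = (1 :: nat)"
      using that_uv in_nbr by (rule d)
    then have "\<not> P u" if "P v"
      using P_only[of v] pos[of P] unit[of v] that that_uv by linarith
    moreover have "\<not> Q u" if "Q v"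
      using Q_only[of v] pos[of Q] unit[of v] that that_uv deg by linarith
    ultimately show ?thesis
      using unit[of u] unit[of v] that_uv by blast
  qed
  have "P x \<longleftrightarrow> Q z" "P y \<longleftrightarrow> Q x" "P z \<longleftrightarrow> Q y"
    using yz one reverse zero irrefl \<open>x \<in> V\<close> by (intro alternate; force)+
  \<comment> \<open>Going backwards around the triangle, \<open>P x\<close> gives
    \<open>Q z\<close>, hence not \<open>P z\<close>, hence not \<open>Q y\<close>, hence
    \<open>P y\<close>, hence \<open>Q x\<close>.\<close>
  then show False
    using \<open>P x\<close> \<open>\<not> Q x\<close> yz by (auto simp: f_def)
qed

text \<open>Indicator sums over the vertices are the form used by the combinatorial lemmas, since
  they expand once the vertices are listed.\<close>

lemma out_degree_with_proj:
  assumes "finite (pverts D)" "parcs D \<subseteq> UNIV \<times> pverts D"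
  shows "out_degree (with_proj D) v = (\<Sum>w\<in>pverts D. of_bool ((v, w) \<in> parcs D))"
proof -
  have "out_arcs (with_proj D) v = Pair v ` {w \<in> pverts D. (v, w) \<in> parcs D}"
    using assms(2) by (auto simp: out_arcs_def)
  then have "out_degree (with_proj D) v = card {w \<in> pverts D. (v, w) \<in> parcs D}"
    by (simp add: out_degree_def card_image inj_on_def)
  then show ?thesis
    using assms(1) by (simp add: Collect_conj_eq Int_commute)
qed

lemma card_firing_in_arcs:
  assumes "finite (pverts D)" "parcs D \<subseteq> pverts D \<times> UNIV"
  shows "card {e \<in> in_arcs (with_proj D) v. fires D c (fst e)} =
    (\<Sum>u\<in>pverts D. of_bool ((u, v) \<in> parcs D \<and> fires D c u))"
proof -
  have "{e \<in> in_arcs (with_proj D) v. fires D c (fst e)} =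
      (\<lambda>u. (u, v)) ` {u \<in> pverts D. (u, v) \<in> parcs D \<and> fires D c u}"
    using assms(2) by (auto simp: in_arcs_def)
  then have "card {e \<in> in_arcs (with_proj D) v. fires D c (fst e)} =
      card {u \<in> pverts D. (u, v) \<in> parcs D \<and> fires D c u}"
    by (simp add: card_image inj_on_def)
  then show ?thesis
    using assms(1) by (simp add: Collect_conj_eq Int_commute Int_left_commute)
qed

lemma period_2_tournament_card_le_4:
  assumes fin: "finite (pverts D)" and "card (pverts D) \<le> 4"
    and wf: "parcs D \<subseteq> pverts D \<times> pverts D"
    and tournament: "\<And>u v. u \<in> pverts D \<Longrightarrow> v \<in> pverts D \<Longrightarrow> u \<noteq> v \<Longrightarrow>
      (u, v) \<in> parcs D \<longleftrightarrow> (v, u) \<notin> parcs D"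
    and irrefl: "\<And>v. (v, v) \<notin> parcs D"
    and period: "\<And>v. v \<in> pverts D \<Longrightarrow> fire_step D (fire_step D c) v = c v"
    and "v \<in> pverts D"
  shows "fire_step D c v = c v"
proof -
  define c' where "c' = fire_step D c"
  let ?V = "pverts D"
  let ?E = "\<lambda>u v. (u, v) \<in> parcs D"
  let ?d = "\<lambda>v. \<Sum>w\<in>?V. of_bool (?E v w) :: nat"
  let ?in = "\<lambda>c v. \<Sum>u\<in>?V. of_bool (?E u v \<and> fires D c u) :: nat"
  have d: "out_degree (with_proj D) v = ?d v" for v
    using fin wf by (intro out_degree_with_proj) auto
  have step: "fire_step D c v = (if fires D c v then c v - ?d v else c v) + ?in c v" for c v
    using fin wf by (subst fire_step_def, subst card_firing_in_arcs) (auto simp: d)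
  have fires: "fires D c v \<longleftrightarrow> ?d v \<le> c v" for c v
    by (simp add: fires_def d)
  \<comment> \<open>Moving the chips sent to the other side removes the natural-number
    subtraction.\<close>
  have there: "c' v + of_bool (fires D c v) * ?d v = c v + ?in c v" for v
    unfolding c'_def step by (cases "fires D c v") (simp_all add: fires del: sum_of_bool_eq)
  have return: "c v + of_bool (fires D c' v) * ?d v = c' v + ?in c' v" if "v \<in> ?V" for v
    unfolding period[OF that, folded c'_def, symmetric] step[of c']
    by (cases "fires D c' v") (simp_all add: fires del: sum_of_bool_eq)
  have balance: "(of_bool (fires D c v) + of_bool (fires D c' v)) * ?d v = ?in c v + ?in c' v"
    if "v \<in> ?V" for v
    using there[of v] return[OF that] unfolding distrib_right by linarith
  \<comment> \<open>Starting with at least \<open>?d v\<close> chips and paying \<open>?d v\<close>,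
    the vertex ends below \<open>?d v\<close> only if it receives fewer than that.\<close>
  have only: "?in c v < ?d v" if "v \<in> ?V" "fires D c v" "\<not> fires D c' v" for v
    using that there[of v] fires[of c v] fires[of c' v] by (simp del: sum_of_bool_eq)
  have only': "?in c' v < ?d v" if "v \<in> ?V" "fires D c' v" "\<not> fires D c v" for v
    using that return[of v] fires[of c' v] fires[of c v] by (simp del: sum_of_bool_eq)
  have "\<not> (fires D c v \<and> \<not> fires D c' v)" if "v \<in> ?V" for v
    using tournament_card_le_4_no_single_firing[OF fin assms(2) that tournament irrefl
        balance only only'] by blast
  \<comment> \<open>The same lemma with the two rounds exchanged; the sums in \<open>balance\<close>
    are commuted to match.\<close>
  moreover have "\<not> (fires D c' v \<and> \<not> fires D c v)" if "v \<in> ?V" for v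
    using tournament_card_le_4_no_single_firing[OF fin assms(2) that tournament irrefl
        balance[unfolded add.commute[of "of_bool (fires D c _)"] add.commute[of "?in c _"]]
        only' only] by blast
  ultimately have same: "fires D c v \<longleftrightarrow> fires D c' v" if "v \<in> ?V" for v
    using that by blast
  then have "?in c v = ?in c' v"
    by (intro sum.cong) auto
  \<comment> \<open>Both rounds change the chips on \<open>v\<close> by the same amount, and the two
    changes cancel, so each is 0.\<close>
  then have "c' v = c v"
    using there[of v, unfolded same[OF \<open>v \<in> ?V\<close>]] return[OF \<open>v \<in> ?V\<close>] by linarith
  then show ?thesis
    by (simp add: c'_def)
qed

theorem lemma3p7:
  fixes n :: nat and G D :: "'a pair_pre_digraph" and c :: "'a chips"
  assumes "0 < n" and "n \<le> 4"
    and "complete_digraph n (with_proj G)"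
    and "orientation_of D G"
  shows "\<not> has_period D c 2"
proof
  have fin: "finite (pverts G)" and card: "card (pverts G) = n"
    and complete: "parcs G = {(u, v). (u, v) \<in> pverts G \<times> pverts G \<and> u \<noteq> v}"
    using assms(3) unfolding complete_digraph_pair_def by blast+
  have verts: "pverts D = pverts G" and arcs: "parcs D \<subseteq> parcs G"
    and one: "\<And>u v. (u, v) \<in> parcs G \<Longrightarrow> (u, v) \<in> parcs D \<longleftrightarrow> (v, u) \<notin> parcs D"
    using \<open>orientation_of D G\<close> by (auto simp: orientation_of_def)
  assume "has_period D c 2"
  then have "eventually_repeats D c 2" and no_1: "\<not> eventually_repeats D c 1"
    by (auto simp: has_period_def)
  then obtain t0 where
    t0: "\<And>t v. t \<ge> t0 \<Longrightarrow> v \<in> pverts D \<Longrightarrow> chips_at D c (t + 2) v = chips_at D c t v"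
    unfolding eventually_repeats_def by metis
  \<comment> \<open>Every position from round \<open>t0\<close> on returns after two rounds and is
    therefore fixed, so that 1 already works as a period, against the minimality of 2.\<close>
  have "chips_at D c (t + 1) v = chips_at D c t v" if "t \<ge> t0" "v \<in> pverts D" for t v
  proof -
    have "fire_step D (chips_at D c t) v = chips_at D c t v"
    proof (rule period_2_tournament_card_le_4)
      show "finite (pverts D)"
        using fin verts by simp
      show "card (pverts D) \<le> 4"
        using card verts \<open>n \<le> 4\<close> by simp
      show "fire_step D (fire_step D (chips_at D c t)) v = chips_at D c t v"
        if "v \<in> pverts D" for v
        using t0[OF \<open>t \<ge> t0\<close> that] by (simp add: chips_at_def)
      show "(u, v) \<in> parcs D \<longleftrightarrow> (v, u) \<notin> parcs D"
        if "u \<in> pverts D" "v \<in> pverts D" "u \<noteq> v" for u v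
        using one[of u v] that complete verts by blast
    qed (use that arcs complete verts in auto)
    then show ?thesis
      by (simp add: chips_at_def)
  qed
  then have "eventually_repeats D c 1"
    unfolding eventually_repeats_def by metis
  with no_1 show False ..
qed

end
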